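(* Algorithm A (described in the context), with spatial locality $\Delta=\delta D$, is $\min\{2.04,\,1+\frac{1+\delta}{1+\beta}\}$-competitive for nomadic online TSP defined on an interval of length $D$, where $0\le\delta\le 1$ and $0\le \beta=\frac{\min\{\mathbb{L},\mathbb{R}\}}{D}\le\frac12$.
   Context: Model. The metric is a line segment of length $D$ containing a distinguished origin $o$. A single server starts at $o$ at time $0$ and moves at unit speed. Requests $r_i=(t_i,e_i)$ with release time $t_i\ge0$ and position $e_i$ are revealed online only at time $t_i$ (several may arrive at once, at arbitrary times). A request is served when the server visits $e_i$ at a time $\ge t_i$; its completion time is that time. Nomadic: the cost $OL(\sigma)$ is the maximum completion time (no return to $o$). $OPT(\sigma)$ is the optimal offline cost knowing $\sigma$ at time 0. Spatial locality $\Delta=\delta D$: requests released at time $t$ lie within distance $\Delta$ of the server's position $pos_{OL}(t)$. $L',R'$ denote the two extreme positions of the points in $\{e_i\}\cup\{o\}$, $\mathbb{L}=|o-L'|$, $\mathbb{R}=|o-R'|$, with $D=\mathbb{L}+\mathbb{R}$. $c$-competitive means $OL(\sigma)\le c\cdot OPT(\sigma)$ for all admissible $\sigma$. Algorithm A: if $1+\frac{1+\delta}{1+\beta}\ge 2.04$, run the 2.04-competitive nomadic online TSP line algorithm of Bjelde et al. for the model without spatial information. Otherwise: when no outstanding request exists, the server stays put. Whenever new request(s) arrive at time $t$, let $S$ be the set of outstanding requests; let $L$ be the position of a request of $S$ farthest in one direction and $R$ the position of a request of $S$ farthest in the opposite direction. If $L$ and $R$ lie on the same side of $pos_{OL}(t)$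 (including $pos_{OL}(t)$), let $T$ be the path from $pos_{OL}(t)$ to whichever of $L,R$ is farther; otherwise, if $dist(pos_{OL}(t),L)\le dist(pos_{OL}(t),R)$, $T$ goes from $pos_{OL}(t)$ to $L$ then to $R$, else to $R$ then to $L$. The server traverses $T$ until a new request arrives (then recompute) or $T$ is completed (then wait). *)

theory Defs
  imports "HOL-Analysis.Analysis"
begin

text \<open>
  Coordinates are chosen so that the origin is \<open>0\<close>; a metric is a set \<open>X\<close> of reals with the
  usual distance.  A request is a pair (release time, position).
\<close>

type_synonym request = "real \<times> real"

definition request_seq :: "real set \<Rightarrow> request list \<Rightarrow> bool" where
  "request_seq X \<sigma> \<longleftrightarrow> \<sigma> \<noteq> [] \<and> (\<forall>(t, e) \<in> set \<sigma>. 0 \<le> t \<and> e \<in> X)"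

text \<open>Speed is at most one, since a server may also wait.\<close>

definition tour :: "real set \<Rightarrow> (real \<Rightarrow> real) \<Rightarrow> bool" where
  "tour X p \<longleftrightarrow> p 0 = 0 \<and> p ` {0..} \<subseteq> X \<and> lipschitz_on 1 {0..} p"

definition serves :: "(real \<Rightarrow> real) \<Rightarrow> request list \<Rightarrow> bool" where
  "serves p \<sigma> \<longleftrightarrow> (\<forall>(t, e) \<in> set \<sigma>. \<exists>s\<ge>t. p s = e)"

definition completion_time :: "(real \<Rightarrow> real) \<Rightarrow> request \<Rightarrow> real" where
  "completion_time p = (\<lambda>(t, e). Inf {s. t \<le> s \<and> p s = e})"

text \<open>Only meaningful for tours that serve all of \<open>\<sigma>\<close>.\<close>

definition cost :: "(real \<Rightarrow> real) \<Rightarrow> request list \<Rightarrow> real" where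
  "cost p \<sigma> = Max (completion_time p ` set \<sigma>)"

definition OPT :: "real set \<Rightarrow> request list \<Rightarrow> real" where
  "OPT X \<sigma> = Inf {cost p \<sigma> | p. tour X p \<and> serves p \<sigma>}"

text \<open>
  A deterministic algorithm maps a request sequence to the resulting server trajectory.  It is
  online if the position at time \<open>t\<close> depends only on the requests released up to time \<open>t\<close>.
\<close>

type_synonym algorithm = "request list \<Rightarrow> real \<Rightarrow> real"

definition online_algorithm :: "real set \<Rightarrow> algorithm \<Rightarrow> bool" where
  "online_algorithm X alg \<longleftrightarrow>
     (\<forall>\<sigma>. request_seq X \<sigma> \<longrightarrow> tour X (alg \<sigma>)) \<and>
     (\<forall>\<sigma> \<sigma>' t. request_seq X \<sigma> \<longrightarrow> request_seq X \<sigma>' \<longrightarrow> 0 \<le> t \<longrightarrow>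
        filter (\<lambda>r. fst r \<le> t) \<sigma> = filter (\<lambda>r. fst r \<le> t) \<sigma>' \<longrightarrow> alg \<sigma> t = alg \<sigma>' t)"

text \<open>\<open>\<Sigma>\<close> is the class of admissible request sequences; it may depend on the algorithm.\<close>

definition competitive :: "real set \<Rightarrow> request list set \<Rightarrow> real \<Rightarrow> algorithm \<Rightarrow> bool" where
  "competitive X \<Sigma> c alg \<longleftrightarrow> online_algorithm X alg \<and>
     (\<forall>\<sigma> \<in> \<Sigma>. serves (alg \<sigma>) \<sigma> \<and> cost (alg \<sigma>) \<sigma> \<le> c * OPT X \<sigma>)"

definition left_extent :: "request list \<Rightarrow> real" where
  "left_extent \<sigma> = dist 0 (Min (insert 0 (snd ` set \<sigma>)))"

definition right_extent :: "request list \<Rightarrow> real" where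
  "right_extent \<sigma> = dist 0 (Max (insert 0 (snd ` set \<sigma>)))"

definition spatially_local :: "real \<Rightarrow> algorithm \<Rightarrow> request list \<Rightarrow> bool" where
  "spatially_local \<Delta> alg \<sigma> \<longleftrightarrow> (\<forall>(t, e) \<in> set \<sigma>. dist e (alg \<sigma> t) \<le> \<Delta>)"

text \<open>
  The sequences on the segment \<open>X\<close> of length \<open>D\<close> obeying spatial locality \<open>\<delta> * D\<close> with respect
  to \<open>alg\<close>.  The requested points together with the origin span all of \<open>X\<close>.
\<close>

definition admissible :: "real set \<Rightarrow> real \<Rightarrow> real \<Rightarrow> real \<Rightarrow> algorithm \<Rightarrow> request list set" where
  "admissible X D \<delta> \<beta> alg = {\<sigma>. request_seq X \<sigma> \<and>
     left_extent \<sigma> + right_extent \<sigma> = D \<and>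
     \<beta> = min (left_extent \<sigma>) (right_extent \<sigma>) / D \<and>
     spatially_local (\<delta> * D) alg \<sigma>}"

definition outstanding :: "(real \<Rightarrow> real) \<Rightarrow> request list \<Rightarrow> real \<Rightarrow> request set" where
  "outstanding p \<sigma> \<tau> = {(t, e) \<in> set \<sigma>. t \<le> \<tau> \<and> \<not> (\<exists>s. t \<le> s \<and> s \<le> \<tau> \<and> p s = e)}"

text \<open>The waypoints of the path \<open>T\<close> for a server at \<open>x\<close> with outstanding requests \<open>S\<close>.\<close>

definition waypoints :: "real \<Rightarrow> request set \<Rightarrow> real list" where
  "waypoints x S =
     (if S = {} then []
      else let L = Min (snd ` S); R = Max (snd ` S) in
        if (L \<le> x \<and> R \<le> x) \<or> (x \<le> L \<and> x \<le> R)
        then (if dist x L \<le> dist x R then [R] else [L])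
        else (if dist x L \<le> dist x R then [L, R] else [R, L]))"

text \<open>Position after travelling for time \<open>s\<close> at unit speed from \<open>x\<close> through the given waypoints.\<close>

fun walk :: "real \<Rightarrow> real list \<Rightarrow> real \<Rightarrow> real" where
  "walk x [] s = x"
| "walk x (y # ys) s =
     (if s \<le> dist x y then x + s * sgn (y - x) else walk y ys (s - dist x y))"

text \<open>The list argument holds the times at which the path is recomputed, latest first.\<close>

fun replan :: "request list \<Rightarrow> real list \<Rightarrow> real \<Rightarrow> real" where
  "replan \<sigma> [] t = 0"
| "replan \<sigma> (\<tau> # \<tau>s) t =
     (if t \<le> \<tau> then replan \<sigma> \<tau>s t
      else let p = replan \<sigma> \<tau>s in
        walk (p \<tau>) (waypoints (p \<tau>) (outstanding p \<sigma> \<tau>)) (t - \<tau>))"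

text \<open>
  \<open>B\<close> stands for the algorithm for the model without spatial information that is run
  as a black box.
\<close>

definition algorithm_A :: "algorithm \<Rightarrow> real \<Rightarrow> real \<Rightarrow> algorithm" where
  "algorithm_A B \<delta> \<beta> \<sigma> =
     (if 1 + (1 + \<delta>) / (1 + \<beta>) \<ge> 2.04 then B \<sigma>
      else replan \<sigma> (rev (sorted_list_of_set (fst ` set \<sigma>))))"

end

theory Submission
  imports Defs
begin

text \<open>
  When a request arrives at time \<open>\<tau>\<close> with the server at \<open>x\<close>, two outstanding requests cannot
  both be farther than \<open>\<Delta> = \<delta> * D\<close> from \<open>x\<close> on opposite sides: both would be old, so the server
  has been heading for the nearer extreme ever since the previous arrival, and that extreme was
  then within \<open>\<Delta>\<close>.  Hence the path computed at the last arrival has length at most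
  \<open>(1 + \<delta>) * D\<close>.  The optimum is at least the last release time, and at least \<open>(1 + \<beta>) * D\<close> as
  both ends of the segment must be visited from the origin.
\<close>

section \<open>Walks through waypoints\<close>

text \<open>The triangle inequality through \<open>f c = g c\<close> loses nothing on the line: for
  \<open>s \<le> c \<le> t\<close> the distances to \<open>c\<close> add up to
  \<open>dist s t\<close>. This keeps trajectories at unit speed across waypoints and
  recomputations.\<close>

lemma lipschitz_on_glue:
  fixes f g :: "real \<Rightarrow> 'a::metric_space"
  assumes f: "lipschitz_on C A f" and g: "lipschitz_on C B g" and eq: "f c = g c"
    and "c \<in> A" "c \<in> B" "A \<subseteq> {..c}" "B \<subseteq> {c..}"
  shows "lipschitz_on C (A \<union> B) (\<lambda>t. if t \<le> c then f t else g t)" (is "lipschitz_on C _ ?h")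
proof (rule lipschitz_onI)
  show "0 \<le> C" using f by (rule lipschitz_on_nonneg)
  have hA: "?h t = f t" if "t \<in> A" for t using that assms(6) by auto
  have hB: "?h t = g t" if "t \<in> B" for t
    using that assms(7) eq by (cases "t = c") (auto dest!: subsetD)
  have mixed: "dist (?h s) (?h t) \<le> C * dist s t" if "s \<in> A" "t \<in> B" for s t
  proof -
    have "dist (?h s) (?h t) \<le> dist (f s) (f c) + dist (g c) (g t)"
      using that hA hB eq dist_triangle[of "f s" "g t" "f c"] by simp
    also have "\<dots> \<le> C * dist s c + C * dist c t"
      using that assms by (intro add_mono lipschitz_onD[OF f] lipschitz_onD[OF g])
    also have "\<dots> = C * dist s t"
    proof -
      have "s \<le> c" "c \<le> t" using that assms(6,7) by auto
      then show ?thesis by (simp add: dist_real_def flip: distrib_left)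
    qed
    finally show ?thesis .
  qed
  fix s t assume "s \<in> A \<union> B" "t \<in> A \<union> B"
  then consider "s \<in> A" "t \<in> A" | "s \<in> B" "t \<in> B" | "s \<in> A" "t \<in> B" | "t \<in> A" "s \<in> B"
    by blast
  then show "dist (?h s) (?h t) \<le> C * dist s t"
  proof cases
    case 1
    then show ?thesis unfolding hA[OF 1(1)] hA[OF 1(2)] by (rule lipschitz_onD[OF f])
  next
    case 2
    then show ?thesis unfolding hB[OF 2(1)] hB[OF 2(2)] by (rule lipschitz_onD[OF g])
  next
    case 3
    then show ?thesis by (rule mixed)
  next
    case 4
    from mixed[OF this] show ?thesis by (simp only: dist_commute)
  qed
qed

lemma lipschitz_on_shift:
  fixes f :: "real \<Rightarrow> 'a::metric_space"
  assumes "lipschitz_on C {0..} f"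
  shows "lipschitz_on C {c..} (\<lambda>t. f (t - c))"
proof (rule lipschitz_onI)
  show "0 \<le> C" using assms by (rule lipschitz_on_nonneg)
  fix s t assume "s \<in> {c..}" "t \<in> {c..}"
  then show "dist (f (s - c)) (f (t - c)) \<le> C * dist s t"
    using lipschitz_onD[OF assms, of "s - c" "t - c"] by (simp add: dist_real_def)
qed

lemma walk_0 [simp]: "walk x ys 0 = x"
  by (cases ys) auto

lemma walk_lipschitz: "lipschitz_on 1 {0..} (walk x ys)"
proof (induction ys arbitrary: x)
  case Nil
  then show ?case by (intro lipschitz_onI) auto
next
  case (Cons y ys)
  let ?d = "dist x y"
  have 1: "lipschitz_on 1 {0..?d} (\<lambda>s. x + s * sgn (y - x))"
    by (intro lipschitz_onI)
      (auto simp: dist_real_def sgn_real_def simp flip: left_diff_distrib)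
  have 2: "lipschitz_on 1 {?d..} (\<lambda>s. walk y ys (s - ?d))"
    by (rule lipschitz_on_shift[OF Cons.IH])
  have "lipschitz_on 1 ({0..?d} \<union> {?d..})
      (\<lambda>s. if s \<le> ?d then x + s * sgn (y - x) else walk y ys (s - ?d))"
    by (rule lipschitz_on_glue[OF 1 2]) (auto simp: dist_real_def sgn_real_def)
  moreover have "{0..d} \<union> {d..} = {0..}" if "0 \<le> d" for d :: real using that by auto
  ultimately show ?case by simp
qed

lemma walk_in_interval:
  assumes "x \<in> {a..b}" "set ys \<subseteq> {a..b}" "0 \<le> s"
  shows "walk x ys s \<in> {a..b}"
  using assms
proof (induction ys arbitrary: x s)
  case (Cons y ys)
  show ?case
  proof (cases "s \<le> dist x y")
    case True
    then show ?thesis using Cons.prems by (auto simp: dist_real_def sgn_real_def)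
  next
    case False
    then show ?thesis using Cons by simp
  qed
qed auto

lemma walk_first_waypoint: "walk x (y # ys) (dist x y) = y"
  by (auto simp: dist_real_def sgn_real_def)

lemma walk_second_waypoint: "walk x (y # z # zs) (dist x y + dist y z) = z"
  \<comment> \<open>If \<open>y = z\<close>, the second leg has length 0 and the time still falls
    into the first branch of \<open>walk\<close>, hence the case split.\<close>
  using walk_first_waypoint[of y z zs] walk_first_waypoint[of x y "z # zs"]
  by (cases "y = z") (auto simp del: walk.simps(2) simp: walk.simps(2)[of x])

lemma continuous_hits_between:
  fixes p :: "real \<Rightarrow> real"
  assumes "continuous_on {u..v} p" "u \<le> v" "e \<in> closed_segment (p u) (p v)"
  shows "\<exists>s\<in>{u..v}. p s = e"
  using assms IVT'[of p u e v] IVT2'[of p v e u] unfolding closed_segment_eq_real_ivl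
  by (auto split: if_splits)

section \<open>The path planned for one set of outstanding requests\<close>

lemma set_waypoints:
  assumes "finite S"
  shows "set (waypoints x S) \<subseteq> snd ` S"
proof (cases "S = {}")
  case False
  then have "Min (snd ` S) \<in> snd ` S" "Max (snd ` S) \<in> snd ` S"
    using assms by (auto intro!: Min_in Max_in simp del: Min_in Max_in)
  then show ?thesis by (auto simp: waypoints_def Let_def)
qed (auto simp: waypoints_def)

text \<open>The invariant at arrivals. Quantifying over pairs instead of using \<open>Min\<close>
  and \<open>Max\<close> makes it hold also when nothing is outstanding.\<close>

definition nearly_one_sided :: "real \<Rightarrow> real \<Rightarrow> real set \<Rightarrow> bool" where
  "nearly_one_sided \<Delta> x E \<longleftrightarrow> (\<forall>l\<in>E. \<forall>r\<in>E. x - \<Delta> \<le> l \<or> r \<le> x + \<Delta>)"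

text \<open>If the requests lie on one side, a single leg inside \<open>{a..b}\<close> sweeps them.
  Otherwise the invariant puts the nearer extreme within \<open>\<Delta>\<close>, and the second
  leg, from one extreme to the other, sweeps everything in length at most
  \<open>b - a\<close>.\<close>

lemma walk_waypoints_covers:
  assumes "finite S" "snd ` S \<subseteq> {a..b}" "x \<in> {a..b}" "0 \<le> \<Delta>"
    and good: "nearly_one_sided \<Delta> x (snd ` S)" and e: "e \<in> snd ` S"
  shows "\<exists>s\<in>{0..b - a + \<Delta>}. walk x (waypoints x S) s = e"
proof -
  define L where "L = Min (snd ` S)"
  define R where "R = Max (snd ` S)"
  let ?w = "walk x (waypoints x S)"
  have fin: "finite (snd ` S)" and ne: "snd ` S \<noteq> {}" "S \<noteq> {}" using assms by auto
  have LR: "L \<in> snd ` S" "R \<in> snd ` S" "L \<le> e" "e \<le> R"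
    unfolding L_def R_def using fin ne e by (blast intro: Min_in Max_in Min_le Max_ge)+
  have wp: "waypoints x S = (if (L \<le> x \<and> R \<le> x) \<or> (x \<le> L \<and> x \<le> R)
        then (if dist x L \<le> dist x R then [R] else [L])
        else (if dist x L \<le> dist x R then [L, R] else [R, L]))"
    using ne by (simp add: waypoints_def L_def R_def Let_def)
  have bnd: "a \<le> L" "R \<le> b" "a \<le> x" "x \<le> b" using LR assms by auto
  have cont: "continuous_on {u..v} ?w" if "0 \<le> u" for u v
    by (rule continuous_on_subset[OF lipschitz_on_continuous_on[OF walk_lipschitz]])
      (use that in auto)
  have reach: "\<exists>s\<in>{0..b - a + \<Delta>}. ?w s = e"
    if "0 \<le> u" "u \<le> v" "v \<le> b - a + \<Delta>" "e \<in> closed_segment (?w u) (?w v)" for u v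
    using continuous_hits_between[OF cont[OF that(1)] that(2,4)] that by force
  have near: "x - \<Delta> \<le> L \<or> R \<le> x + \<Delta>"
    using good LR unfolding nearly_one_sided_def by blast
  have seg: "e \<in> closed_segment u v" if "u \<le> e \<and> e \<le> v \<or> v \<le> e \<and> e \<le> u" for u v
    using that by (auto simp: closed_segment_eq_real_ivl)
  have one: "\<exists>s\<in>{0..b - a + \<Delta>}. ?w s = e"
    if w: "waypoints x S = y # ys" and y: "y \<in> {a..b}" "x \<le> e \<and> e \<le> y \<or> y \<le> e \<and> e \<le> x" for y ys
  proof (rule reach[of 0 "dist x y"])
    show "dist x y \<le> b - a + \<Delta>" using y bnd assms by (auto simp: dist_real_def)
    show "e \<in> closed_segment (?w 0) (?w (dist x y))"
      unfolding w walk_first_waypoint using y by (auto intro: seg)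
  qed auto
  have two: "\<exists>s\<in>{0..b - a + \<Delta>}. ?w s = e"
    if w: "waypoints x S = [y, z]" and yz: "{y, z} = {L, R}" and d: "dist x y \<le> \<Delta>" for y z
  proof (rule reach[of "dist x y" "dist x y + dist y z"])
    show "dist x y + dist y z \<le> b - a + \<Delta>"
      using yz d bnd LR by (auto simp: dist_real_def doubleton_eq_iff)
    show "e \<in> closed_segment (?w (dist x y)) (?w (dist x y + dist y z))"
      unfolding w walk_first_waypoint walk_second_waypoint
      using yz LR by (auto simp: doubleton_eq_iff intro: seg)
  qed auto
  consider "L \<le> x \<and> R \<le> x" | "x \<le> L \<and> x \<le> R" | "L < x" "x < R"
    using LR(3,4) by linarith
  then show ?thesis
  proof cases
    case 1
    \<comment> \<open>A tie of distances on one side forces \<open>L = R\<close>, so it does not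
      matter which of them \<open>waypoints\<close> picks.\<close>
    then have "waypoints x S = [L]" using wp LR by (auto simp: dist_real_def)
    then show ?thesis by (rule one) (use 1 LR bnd in auto)
  next
    case 2
    then have "waypoints x S = [R]" using wp LR by (auto simp: dist_real_def)
    then show ?thesis by (rule one) (use 2 LR bnd in auto)
  next
    case 3
    show ?thesis
    proof (cases "dist x L \<le> dist x R")
      case True
      then have "waypoints x S = [L, R]" using wp 3 by simp
      then show ?thesis by (rule two) (use 3 near True in \<open>auto simp: dist_real_def\<close>)
    next
      case False
      then have "waypoints x S = [R, L]" using wp 3 by simp
      then show ?thesis by (rule two) (use 3 near False in \<open>auto simp: dist_real_def\<close>)
    qed
  qed
qed

text \<open>
  As long as neither \<open>l\<close> nor \<open>r\<close> is reached, the server is still on the first leg, approaching the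
  nearer extreme.
\<close>

lemma walk_waypoints_nearly_one_sided:
  assumes "finite S" and good: "nearly_one_sided \<Delta> x (snd ` S)"
    and lr: "l \<in> snd ` S" "r \<in> snd ` S"
    and "0 \<le> s" "l \<le> walk x (waypoints x S) s" "walk x (waypoints x S) s \<le> r"
    and unserved: "\<And>u. 0 \<le> u \<Longrightarrow> u \<le> s \<Longrightarrow> walk x (waypoints x S) u \<notin> {l, r}"
  shows "walk x (waypoints x S) s - \<Delta> \<le> l \<or> r \<le> walk x (waypoints x S) s + \<Delta>"
proof -
  define L where "L = Min (snd ` S)"
  define R where "R = Max (snd ` S)"
  let ?w = "walk x (waypoints x S)"
  have fin: "finite (snd ` S)" and ne: "snd ` S \<noteq> {}" "S \<noteq> {}" using assms by auto
  have LR: "L \<in> snd ` S" "R \<in> snd ` S" "L \<le> l" "r \<le> R"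
    unfolding L_def R_def using fin ne lr by (blast intro: Min_in Max_in Min_le Max_ge)+
  have near: "x - \<Delta> \<le> L \<or> R \<le> x + \<Delta>"
    using good LR unfolding nearly_one_sided_def by blast
  \<comment> \<open>By the intermediate value theorem, a request point between the start and a later
    position would already have been visited.\<close>
  have avoid: "e \<notin> closed_segment (?w 0) (?w v)" if "0 \<le> v" "v \<le> s" "e \<in> {l, r}" for e v
  proof
    assume e: "e \<in> closed_segment (?w 0) (?w v)"
    have "continuous_on {0..v} ?w"
      using lipschitz_on_continuous_on[OF walk_lipschitz] by (rule continuous_on_subset) auto
    from continuous_hits_between[OF this \<open>0 \<le> v\<close> e] obtain u where "0 \<le> u" "u \<le> v" "?w u = e"
      by auto
    then show False using unserved[of u] that by auto
  qed
  \<comment> \<open>The server is now between \<open>l\<close> and \<open>r\<close>; had it started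
    outside, it would have crossed one of them.\<close>
  have x: "l < x" "x < r"
    using avoid[of s l] avoid[of s r] assms(5-7)
    by (auto simp: closed_segment_eq_real_ivl split: if_splits)
  have wp: "waypoints x S = (if dist x L \<le> dist x R then [L, R] else [R, L])"
    using ne x LR by (simp add: waypoints_def Let_def flip: L_def R_def)
  have leg: "?w s = x + s * sgn (y - x)"
    if w: "waypoints x S = y # ys" and y: "y = L \<or> y = R" for y ys
  proof -
    \<comment> \<open>Finishing the first leg would pass over \<open>l\<close> if
      \<open>y = L\<close>, or over \<open>r\<close> if \<open>y = R\<close>.\<close>
    have "\<not> dist x y \<le> s"
    proof
      assume "dist x y \<le> s"
      then have "l \<notin> closed_segment x y" "r \<notin> closed_segment x y"
        using avoid[of "dist x y"] unfolding w walk_first_waypoint walk_0 by auto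
      then show False using y x LR by (auto simp: closed_segment_eq_real_ivl split: if_splits)
    qed
    then show ?thesis by (simp add: w)
  qed
  show ?thesis
  \<comment> \<open>Either disjunct of \<open>near\<close> bounds the distance to the nearer extreme
    by \<open>\<Delta>\<close>, and moving towards that extreme only shortens it.\<close>
  proof (cases "dist x L \<le> dist x R")
    case True
    then have "?w s = x - s" using leg[of L] wp x LR by auto
    then show ?thesis using True near x LR assms(5) by (auto simp: dist_real_def)
  next
    case False
    then have "?w s = x + s" using leg[of R] wp x LR by auto
    then show ?thesis using False near x LR assms(5) by (auto simp: dist_real_def)
  qed
qed

section \<open>Replanning\<close>

lemma outstanding_subset: "outstanding p \<sigma> \<tau> \<subseteq> set \<sigma>"
  by (auto simp: outstanding_def)

lemma finite_outstanding [simp]: "finite (outstanding p \<sigma> \<tau>)"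
  by (rule finite_subset[OF outstanding_subset]) simp

lemma outstanding_cong:
  assumes "\<And>s. s \<le> \<tau> \<Longrightarrow> p s = q s" "{r \<in> set \<sigma>. fst r \<le> \<tau>} = {r \<in> set \<sigma>'. fst r \<le> \<tau>}"
  shows "outstanding p \<sigma> \<tau> = outstanding q \<sigma>' \<tau>"
proof -
  have eq: "outstanding p \<sigma> \<tau> =
      {r \<in> {r \<in> set \<sigma>. fst r \<le> \<tau>}. \<not> (\<exists>s. fst r \<le> s \<and> s \<le> \<tau> \<and> p s = snd r)}" for p \<sigma>
    by (auto simp: outstanding_def)
  show ?thesis unfolding eq assms(2) using assms(1) by auto
qed

text \<open>Each new walk starts at the position where the previous plan was at time
  \<open>\<tau>\<close>, so the pieces glue.\<close>

lemma replan_lipschitz: "lipschitz_on 1 UNIV (replan \<sigma> \<tau>s)"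
proof (induction \<tau>s)
  case Nil
  then show ?case by (intro lipschitz_onI) auto
next
  case (Cons \<tau> \<tau>s)
  let ?p = "replan \<sigma> \<tau>s"
  let ?w = "walk (?p \<tau>) (waypoints (?p \<tau>) (outstanding ?p \<sigma> \<tau>))"
  have 1: "lipschitz_on 1 {..\<tau>} ?p" by (rule lipschitz_on_subset[OF Cons.IH]) auto
  have 2: "lipschitz_on 1 {\<tau>..} (\<lambda>t. ?w (t - \<tau>))"
    by (rule lipschitz_on_shift[OF walk_lipschitz])
  have "lipschitz_on 1 ({..\<tau>} \<union> {\<tau>..}) (\<lambda>t. if t \<le> \<tau> then ?p t else ?w (t - \<tau>))"
    by (rule lipschitz_on_glue[OF 1 2]) auto
  moreover have "{..\<tau>} \<union> {\<tau>..} = UNIV" by auto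
  ultimately show ?case unfolding replan.simps Let_def by simp
qed

lemma replan_in_interval:
  assumes "snd ` set \<sigma> \<subseteq> {a..b}" "0 \<in> {a..b}"
  shows "replan \<sigma> \<tau>s t \<in> {a..b}"
proof (induction \<tau>s arbitrary: t)
  case (Cons \<tau> \<tau>s)
  let ?p = "replan \<sigma> \<tau>s"
  have "set (waypoints (?p \<tau>) (outstanding ?p \<sigma> \<tau>)) \<subseteq> {a..b}"
    using set_waypoints[OF finite_outstanding] outstanding_subset assms(1) by blast
  then show ?case using Cons.IH walk_in_interval[of "?p \<tau>" a b _ "t - \<tau>"]
    by (simp add: Let_def del: atLeastAtMost_iff)
qed (use assms in auto)

lemma replan_early: "(\<And>\<tau>. \<tau> \<in> set \<tau>s \<Longrightarrow> t \<le> \<tau>) \<Longrightarrow> replan \<sigma> \<tau>s t = 0"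
  by (induction \<tau>s) auto

text \<open>Unfolds the recursion: position and outstanding set at \<open>\<tau>\<close> are read
  off the complete trajectory, not off the plan preceding \<open>\<tau>\<close>. The time
  \<open>t\<close> may equal the next recomputation time, where \<open>replan\<close> still follows
  the old walk.\<close>

lemma replan_between:
  assumes "sorted_wrt (>) \<tau>s" "\<tau> \<in> set \<tau>s" "\<tau> \<le> t" "\<And>\<tau>'. \<tau>' \<in> set \<tau>s \<Longrightarrow> \<tau> < \<tau>' \<Longrightarrow> t \<le> \<tau>'"
  shows "replan \<sigma> \<tau>s t = (let p = replan \<sigma> \<tau>s in
           walk (p \<tau>) (waypoints (p \<tau>) (outstanding p \<sigma> \<tau>)) (t - \<tau>))"
  using assms
proof (induction \<tau>s)
  case (Cons \<rho> \<tau>s)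
  have same: "replan \<sigma> (\<rho> # \<tau>s) s = replan \<sigma> \<tau>s s" if "s \<le> \<rho>" for s
    using that by simp
  have "\<tau> \<le> \<rho>" using Cons.prems by auto
  \<comment> \<open>Outstanding requests at \<open>\<tau>\<close> depend only on positions up to
    \<open>\<tau>\<close>, and the recomputation at \<open>\<rho>\<close> changes none of
    these.\<close>
  then have out: "outstanding (replan \<sigma> (\<rho> # \<tau>s)) \<sigma> \<tau> = outstanding (replan \<sigma> \<tau>s) \<sigma> \<tau>"
    by (intro outstanding_cong) auto
  show ?case
  proof (cases "\<tau> = \<rho>")
    case True
    then have "replan \<sigma> (\<rho> # \<tau>s) t = (let p = replan \<sigma> \<tau>s in
        walk (p \<tau>) (waypoints (p \<tau>) (outstanding p \<sigma> \<tau>)) (t - \<tau>))"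
      using Cons.prems by (auto simp: Let_def)
    then show ?thesis using out same[of \<tau>] True by (simp add: Let_def del: replan.simps)
  next
    case False
    then have "\<tau> \<in> set \<tau>s" "t \<le> \<rho>" using Cons.prems by auto
    then show ?thesis
      using Cons same[of \<tau>] same[of t] out \<open>\<tau> \<le> \<rho>\<close> by (simp add: Let_def del: replan.simps)
  qed
qed auto

lemma replan_cong:
  assumes "{r \<in> set \<sigma>. fst r \<le> t} = {r \<in> set \<sigma>'. fst r \<le> t}" "s \<le> t"
    and "\<And>\<tau>. \<tau> \<in> set \<tau>s \<Longrightarrow> \<tau> \<le> t"
  shows "replan \<sigma> \<tau>s s = replan \<sigma>' \<tau>s s"
  using assms(2,3)
proof (induction \<tau>s arbitrary: s)
  case (Cons \<tau> \<tau>s)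
  have IH: "replan \<sigma> \<tau>s u = replan \<sigma>' \<tau>s u" if "u \<le> t" for u using Cons that by simp
  have "\<tau> \<le> t" using Cons.prems by simp
  moreover have "outstanding (replan \<sigma> \<tau>s) \<sigma> \<tau> = outstanding (replan \<sigma>' \<tau>s) \<sigma>' \<tau>"
    using IH \<open>\<tau> \<le> t\<close> assms(1) by (intro outstanding_cong) auto
  ultimately show ?case using Cons.prems IH by (simp add: Let_def)
qed auto

text \<open>Needed for the online property: the list of recomputation times of
  \<open>replan_all\<close> contains future release times, whose number and values must not
  influence the position at \<open>t\<close>.\<close>

lemma replan_filter:
  assumes "sorted_wrt (>) \<tau>s"
  shows "replan \<sigma> \<tau>s t = replan \<sigma> (filter (\<lambda>\<tau>. \<tau> \<le> t) \<tau>s) t"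
  using assms
proof (induction \<tau>s)
  case (Cons \<tau> \<tau>s)
  show ?case
  proof (cases "\<tau> \<le> t")
    case True
    then have "filter (\<lambda>\<tau>. \<tau> \<le> t) \<tau>s = \<tau>s" using Cons.prems by (intro filter_True) auto
    then show ?thesis using True by simp
  next
    case False
    then show ?thesis using Cons by simp
  qed
qed auto

text \<open>The branch of \<open>algorithm_A\<close> that does not run \<open>B\<close>, freed of
  \<open>\<delta>\<close> and \<open>\<beta>\<close>. Taking the set of release times merges
  simultaneous arrivals into one recomputation.\<close>

definition replan_all :: algorithm where
  "replan_all \<sigma> = replan \<sigma> (rev (sorted_list_of_set (fst ` set \<sigma>)))"

lemma sorted_release_times: "sorted_wrt (>) (rev (sorted_list_of_set (A :: real set)))"
  by (simp add: sorted_wrt_rev)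

lemma replan_all_between:
  assumes "\<tau> \<in> fst ` set \<sigma>" "\<tau> \<le> t" "\<And>\<tau>'. \<tau>' \<in> fst ` set \<sigma> \<Longrightarrow> \<tau> < \<tau>' \<Longrightarrow> t \<le> \<tau>'"
  shows "replan_all \<sigma> t = walk (replan_all \<sigma> \<tau>)
           (waypoints (replan_all \<sigma> \<tau>) (outstanding (replan_all \<sigma>) \<sigma> \<tau>)) (t - \<tau>)"
  using replan_between[OF sorted_release_times, of \<tau> "fst ` set \<sigma>" t \<sigma>] assms
  by (simp add: replan_all_def Let_def)

lemma filter_sorted_list_of_set:
  assumes "finite A"
  shows "filter P (sorted_list_of_set A) = sorted_list_of_set {x \<in> A. P x}"
  by (rule sorted_distinct_set_unique) (use assms in \<open>auto simp: sorted_wrt_filter\<close>)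

lemma online_replan_all:
  assumes "a \<le> 0" "0 \<le> b"
  shows "online_algorithm {a..b} replan_all"
  unfolding online_algorithm_def
proof (intro conjI allI impI)
  fix \<sigma> assume "request_seq {a..b} \<sigma>"
  then have "snd ` set \<sigma> \<subseteq> {a..b}" "\<And>\<tau>. \<tau> \<in> fst ` set \<sigma> \<Longrightarrow> 0 \<le> \<tau>"
    by (auto simp: request_seq_def)
  then show "tour {a..b} (replan_all \<sigma>)"
    unfolding tour_def replan_all_def
    using replan_in_interval[of \<sigma> a b] assms lipschitz_on_subset[OF replan_lipschitz]
    by (auto intro!: replan_early simp del: atLeastAtMost_iff) auto
next
  fix \<sigma> \<sigma>' :: "request list" and t
  assume eq: "filter (\<lambda>r. fst r \<le> t) \<sigma> = filter (\<lambda>r. fst r \<le> t) \<sigma>'"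
  have reqs: "{r \<in> set \<sigma>. fst r \<le> t} = {r \<in> set \<sigma>'. fst r \<le> t}"
    using arg_cong[OF eq, of set] by simp
  \<comment> \<open>Cut off at \<open>t\<close>, the two lists of recomputation times coincide;
    \<open>replan_cong\<close> then compares the trajectories.\<close>
  have "{\<tau> \<in> fst ` set \<sigma>. \<tau> \<le> t} = fst ` {r \<in> set \<sigma>. fst r \<le> t}" for \<sigma> :: "request list" by auto
  then have "{\<tau> \<in> fst ` set \<sigma>. \<tau> \<le> t} = {\<tau> \<in> fst ` set \<sigma>'. \<tau> \<le> t}" using reqs by simp
  then show "replan_all \<sigma> t = replan_all \<sigma>' t"
    unfolding replan_all_def
    by (subst (1 2) replan_filter) 
      (auto simp: sorted_release_times filter_sorted_list_of_set simp flip: rev_filter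
        intro!: replan_cong[OF reqs])
qed

section \<open>The invariant at arrivals and the resulting deadline\<close>

lemma outstandingD:
  assumes "(t, e) \<in> outstanding p \<sigma> \<tau>"
  shows "(t, e) \<in> set \<sigma>" "t \<le> \<tau>" "\<And>s. t \<le> s \<Longrightarrow> s \<le> \<tau> \<Longrightarrow> p s \<noteq> e"
  using assms by (auto simp: outstanding_def)

text \<open>Induction on the number of earlier arrivals. A violating pair would have been
  outstanding at the previous arrival \<open>\<rho>\<close> and unvisited on the walk since then, so
  \<open>walk_waypoints_nearly_one_sided\<close> carries the invariant from \<open>\<rho>\<close> to
  \<open>\<tau>\<close>.\<close>

lemma nearly_one_sided_at_arrivals:
  assumes local: "spatially_local \<Delta> replan_all \<sigma>" and \<tau>: "\<tau> \<in> fst ` set \<sigma>"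
  shows "nearly_one_sided \<Delta> (replan_all \<sigma> \<tau>) (snd ` outstanding (replan_all \<sigma>) \<sigma> \<tau>)"
  using \<tau>
proof (induction "card {\<rho> \<in> fst ` set \<sigma>. \<rho> < \<tau>}" arbitrary: \<tau> rule: less_induct)
  case less
  let ?p = "replan_all \<sigma>"
  let ?before = "{\<rho> \<in> fst ` set \<sigma>. \<rho> < \<tau>}"
  show ?case
    unfolding nearly_one_sided_def
  proof (intro ballI, rule ccontr)
    fix l r
    assume "l \<in> snd ` outstanding ?p \<sigma> \<tau>" "r \<in> snd ` outstanding ?p \<sigma> \<tau>"
    then obtain tl tr where l: "(tl, l) \<in> outstanding ?p \<sigma> \<tau>" and r: "(tr, r) \<in> outstanding ?p \<sigma> \<tau>"
      by auto
    assume "\<not> (?p \<tau> - \<Delta> \<le> l \<or> r \<le> ?p \<tau> + \<Delta>)"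
    then have far: "l < ?p \<tau> - \<Delta>" "?p \<tau> + \<Delta> < r" by auto
    have loc: "dist e (?p t) \<le> \<Delta>" if "(t, e) \<in> set \<sigma>" for t e
      using local that by (auto simp: spatially_local_def)
    \<comment> \<open>Spatial locality places a request released exactly at \<open>\<tau>\<close>
      within \<open>\<Delta>\<close> of the server.\<close>
    have old: "tl < \<tau>" "tr < \<tau>"
      using outstandingD(1,2)[OF l] outstandingD(1,2)[OF r] far loc[of tl l] loc[of tr r]
      by (force simp: dist_real_def less_le)+
    have \<Delta>: "0 \<le> \<Delta>" using loc[OF outstandingD(1)[OF l]] zero_le_dist order_trans by blast
    define \<rho> where "\<rho> = Max ?before"
    have fin: "finite ?before" by simp
    have mem: "tl \<in> ?before" "tr \<in> ?before"
      using old outstandingD(1)[OF l] outstandingD(1)[OF r] by force+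
    then have \<rho>: "\<rho> \<in> ?before" unfolding \<rho>_def using Max_in[OF fin] by blast
    have le_\<rho>: "t \<le> \<rho>" if "t \<in> ?before" for t unfolding \<rho>_def using fin that by (rule Max_ge)
    have "{\<rho>' \<in> fst ` set \<sigma>. \<rho>' < \<rho>} \<subset> ?before" using \<rho> by auto
    then have IH: "nearly_one_sided \<Delta> (?p \<rho>) (snd ` outstanding ?p \<sigma> \<rho>)"
      using \<rho> by (intro less.hyps psubset_card_mono fin) auto
    let ?w = "walk (?p \<rho>) (waypoints (?p \<rho>) (outstanding ?p \<sigma> \<rho>))"
    have step: "?p t = ?w (t - \<rho>)" if "\<rho> \<le> t" "t \<le> \<tau>" for t
    proof (rule replan_all_between)
      show "t \<le> \<tau>'" if "\<tau>' \<in> fst ` set \<sigma>" "\<rho> < \<tau>'" for \<tau>'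
        using le_\<rho>[of \<tau>'] that \<open>t \<le> \<tau>\<close> by force
    qed (use \<rho> \<open>\<rho> \<le> t\<close> in auto)
    have "\<rho> < \<tau>" using \<rho> by simp
    have carry: "e \<in> snd ` outstanding ?p \<sigma> \<rho>"
      if e: "(t, e) \<in> outstanding ?p \<sigma> \<tau>" and "t \<in> ?before" for t e
    proof -
      have "(t, e) \<in> outstanding ?p \<sigma> \<rho>"
        using outstandingD[OF e] le_\<rho>[OF that(2)] \<open>\<rho> < \<tau>\<close> by (auto simp: outstanding_def)
      then show ?thesis by force
    qed
    have "?w (\<tau> - \<rho>) - \<Delta> \<le> l \<or> r \<le> ?w (\<tau> - \<rho>) + \<Delta>"
    proof (rule walk_waypoints_nearly_one_sided[OF finite_outstanding IH])
      show "l \<in> snd ` outstanding ?p \<sigma> \<rho>" "r \<in> snd ` outstanding ?p \<sigma> \<rho>"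
        using carry l r mem by blast+
      show "l \<le> ?w (\<tau> - \<rho>)" "?w (\<tau> - \<rho>) \<le> r"
        using far \<Delta> step[of \<tau>] \<open>\<rho> < \<tau>\<close> by auto
      \<comment> \<open>As \<open>tl\<close> and \<open>tr\<close> are at most
        \<open>\<rho>\<close>, any visit at time \<open>\<rho> + u\<close> would count as
        service.\<close>
      fix u assume "0 \<le> u" "u \<le> \<tau> - \<rho>"
      then show "?w u \<notin> {l, r}"
        using step[of "\<rho> + u"] outstandingD(3)[OF l, of "\<rho> + u"] outstandingD(3)[OF r, of "\<rho> + u"]
          le_\<rho>[OF mem(1)] le_\<rho>[OF mem(2)] by auto
    qed (use \<open>\<rho> < \<tau>\<close> in auto)
    then show False using far step[of \<tau>] \<open>\<rho> < \<tau>\<close> by auto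
  qed
qed

text \<open>After the last arrival the path is never recomputed, so the length bound of
  \<open>walk_waypoints_covers\<close> becomes a deadline.\<close>

lemma replan_all_serves_by:
  assumes seq: "request_seq {a..b} \<sigma>" and "a \<le> 0" "0 \<le> b" "0 \<le> \<Delta>"
    and local: "spatially_local \<Delta> replan_all \<sigma>" and req: "(t, e) \<in> set \<sigma>"
  shows "\<exists>s\<ge>t. s \<le> Max (fst ` set \<sigma>) + (b - a + \<Delta>) \<and> replan_all \<sigma> s = e"
proof -
  let ?p = "replan_all \<sigma>"
  define \<tau> where "\<tau> = Max (fst ` set \<sigma>)"
  have \<tau>: "\<tau> \<in> fst ` set \<sigma>" unfolding \<tau>_def using req by (intro Max_in) auto
  have le_\<tau>: "u \<le> \<tau>" if "u \<in> fst ` set \<sigma>" for u unfolding \<tau>_def using that by (intro Max_ge) auto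
  have "t \<le> \<tau>" using req by (intro le_\<tau>) force
  show ?thesis
  proof (cases "\<exists>s. t \<le> s \<and> s \<le> \<tau> \<and> ?p s = e")
    case True
    then obtain s where "t \<le> s" "s \<le> \<tau>" "?p s = e" by blast
    then show ?thesis using assms(2-4) unfolding \<tau>_def by (intro exI[of _ s]) auto
  next
    case False
    then have e: "e \<in> snd ` outstanding ?p \<sigma> \<tau>"
      using req \<open>t \<le> \<tau>\<close> by (force simp: outstanding_def)
    have X: "snd ` set \<sigma> \<subseteq> {a..b}" using seq by (auto simp: request_seq_def)
    have "?p \<tau> \<in> {a..b}"
      unfolding replan_all_def using X assms by (intro replan_in_interval) auto
    moreover have "snd ` outstanding ?p \<sigma> \<tau> \<subseteq> {a..b}" using X outstanding_subset by blast
    ultimately obtain u where u: "u \<in> {0..b - a + \<Delta>}"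
      "walk (?p \<tau>) (waypoints (?p \<tau>) (outstanding ?p \<sigma> \<tau>)) u = e"
      using walk_waypoints_covers[OF finite_outstanding _ _ \<open>0 \<le> \<Delta>\<close>
          nearly_one_sided_at_arrivals[OF local \<tau>] e] by blast
    have "?p (\<tau> + u) = walk (?p \<tau>) (waypoints (?p \<tau>) (outstanding ?p \<sigma> \<tau>)) (\<tau> + u - \<tau>)"
      by (rule replan_all_between[OF \<tau>]) (use u le_\<tau> in force)+
    then show ?thesis using u \<open>t \<le> \<tau>\<close> unfolding \<tau>_def by (intro exI[of _ "\<tau> + u"]) (auto simp: \<tau>_def)
  qed
qed

section \<open>Costs\<close>

lemma completion_time_le:
  assumes "t \<le> s" "p s = e"
  shows "completion_time p (t, e) \<le> s"
  unfolding completion_time_def using assms by (auto intro!: cInf_lower bdd_belowI[of _ t])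

text \<open>The infimum is a minimum: the visit times from \<open>t\<close> on form a closed set by
  continuity, nonempty since the request is served.\<close>

lemma completion_time_attained:
  assumes "tour X p" "serves p \<sigma>" "(t, e) \<in> set \<sigma>" "0 \<le> t"
  shows "t \<le> completion_time p (t, e)" "p (completion_time p (t, e)) = e"
proof -
  let ?A = "{s. t \<le> s \<and> p s = e}"
  have "continuous_on {0..} p" using assms(1) by (auto simp: tour_def intro: lipschitz_on_continuous_on)
  then have "continuous_on {t..} p" by (rule continuous_on_subset) (use assms in auto)
  then have "closed {s \<in> {t..}. p s = e}"
    by (rule continuous_closed_preimage_constant) auto
  moreover have "{s \<in> {t..}. p s = e} = ?A" by auto
  moreover have "?A \<noteq> {}" using assms(2,3) by (auto simp: serves_def)
  ultimately have "Inf ?A \<in> ?A"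
    by (intro closed_contains_Inf) (auto intro: bdd_belowI[of _ t])
  then show "t \<le> completion_time p (t, e)" "p (completion_time p (t, e)) = e"
    by (auto simp: completion_time_def)
qed

lemma cost_ge: "r \<in> set \<sigma> \<Longrightarrow> completion_time p r \<le> cost p \<sigma>"
  unfolding cost_def by (intro Max_ge) auto

lemma cost_ge_release:
  assumes "request_seq X \<sigma>" "tour X p" "serves p \<sigma>"
  shows "Max (fst ` set \<sigma>) \<le> cost p \<sigma>"
proof -
  have "fst r \<le> cost p \<sigma>" if "r \<in> set \<sigma>" for r
    using completion_time_attained(1)[OF assms(2,3), of "fst r" "snd r"] cost_ge[OF that, of p]
      assms(1) that by (force simp: request_seq_def)
  then show ?thesis using assms(1) by (auto simp: request_seq_def)
qed

text \<open>The end visited first costs at least its distance from the origin, hence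
  \<open>min (- a) b\<close>; reaching the other end takes a further \<open>b - a\<close>.\<close>

lemma cost_ge_span:
  assumes seq: "request_seq {a..b} \<sigma>" and p: "tour {a..b} p" "serves p \<sigma>"
    and ab: "{a, b} \<subseteq> insert 0 (snd ` set \<sigma>)" "a \<le> 0" "0 \<le> b"
  shows "b - a + min (- a) b \<le> cost p \<sigma>"
proof -
  have "0 \<le> Max (fst ` set \<sigma>)"
    using seq by (subst Max_ge_iff) (auto simp: request_seq_def neq_Nil_conv)
  then have "0 \<le> cost p \<sigma>" using cost_ge_release[OF seq p] by linarith
  \<comment> \<open>An end of the segment that is the origin may carry no request; it counts as
    visited at time 0.\<close>
  have visit: "\<exists>s. 0 \<le> s \<and> s \<le> cost p \<sigma> \<and> p s = e" if e: "e \<in> insert 0 (snd ` set \<sigma>)" for e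
  proof (cases "e = 0")
    case True
    then show ?thesis using p \<open>0 \<le> cost p \<sigma>\<close> by (auto simp: tour_def)
  next
    case False
    then obtain t where t: "(t, e) \<in> set \<sigma>" using e by auto
    then have "0 \<le> t" using seq by (auto simp: request_seq_def)
    then show ?thesis
      using completion_time_attained[OF p t] cost_ge[OF t, of p] by (meson order_trans)
  qed
  obtain u v where u: "0 \<le> u" "u \<le> cost p \<sigma>" "p u = a" and v: "0 \<le> v" "v \<le> cost p \<sigma>" "p v = b"
    using visit[of a] visit[of b] ab by auto
  have speed: "dist (p s) (p t) \<le> dist s t" if "0 \<le> s" "0 \<le> t" for s t
    using p(1) lipschitz_onD[of 1 "{0..}" p s t] that by (auto simp: tour_def)
  have "p 0 = 0" using p by (simp add: tour_def)
  then have "- a \<le> u" "b \<le> v" "b - a \<le> \<bar>u - v\<bar>"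
    using speed[of u 0] speed[of v 0] speed[of u v] u v by (auto simp: dist_real_def)
  then show ?thesis using u v by linarith
qed

text \<open>The tour \<open>q\<close> ensures that the infimum is over a nonempty set; the online
  trajectory itself will play this part.\<close>

lemma OPT_ge:
  assumes "tour X q" "serves q \<sigma>" "\<And>p. tour X p \<Longrightarrow> serves p \<sigma> \<Longrightarrow> c \<le> cost p \<sigma>"
  shows "c \<le> OPT X \<sigma>"
  unfolding OPT_def using assms by (intro cInf_greatest) auto

text \<open>The extreme points lie in \<open>{a..b}\<close>, so their extents can add up to
  \<open>b - a\<close> only if they are \<open>a\<close> and \<open>b\<close>.\<close>

lemma extents_span:
  assumes seq: "request_seq {a..b} \<sigma>" and "a \<le> 0" "0 \<le> b"
    and sum: "left_extent \<sigma> + right_extent \<sigma> = b - a"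
  shows "left_extent \<sigma> = - a" "right_extent \<sigma> = b" "{a, b} \<subseteq> insert 0 (snd ` set \<sigma>)"
proof -
  let ?E = "insert 0 (snd ` set \<sigma>)"
  have E: "finite ?E" "?E \<noteq> {}" "?E \<subseteq> {a..b}" using assms by (auto simp: request_seq_def)
  have in_E: "Min ?E \<in> ?E" "Max ?E \<in> ?E" using Min_in Max_in E(1,2) by blast+
  moreover have "Min ?E \<le> 0" "0 \<le> Max ?E" using E by (auto intro: Min_le Max_ge)
  moreover have "a \<le> Min ?E" "Max ?E \<le> b" using in_E E(3) by (meson atLeastAtMost_iff subsetD)+
  ultimately have "left_extent \<sigma> = - Min ?E" "right_extent \<sigma> = Max ?E"
    by (simp_all only: left_extent_def right_extent_def dist_real_def)
  with sum \<open>a \<le> Min ?E\<close> \<open>Max ?E \<le> b\<close> have "Min ?E = a" "Max ?E = b" by linarith+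
  then show "left_extent \<sigma> = - a" "right_extent \<sigma> = b" "{a, b} \<subseteq> ?E"
    using in_E \<open>left_extent \<sigma> = - Min ?E\<close> \<open>right_extent \<sigma> = Max ?E\<close> by auto
qed

section \<open>Competitive ratios of the two branches\<close>

lemma competitive_replan_all:
  assumes "a \<le> 0" "0 \<le> b" "D = b - a" "0 < D" "0 \<le> \<delta>" "0 \<le> \<beta>"
  shows "competitive {a..b} (admissible {a..b} D \<delta> \<beta> replan_all)
           (1 + (1 + \<delta>) / (1 + \<beta>)) replan_all"
  unfolding competitive_def
proof (intro conjI ballI)
  show online: "online_algorithm {a..b} replan_all" using assms by (intro online_replan_all)
  fix \<sigma> assume "\<sigma> \<in> admissible {a..b} D \<delta> \<beta> replan_all"
  then have seq: "request_seq {a..b} \<sigma>" and sum: "left_extent \<sigma> + right_extent \<sigma> = b - a"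
    and \<beta>: "\<beta> = min (left_extent \<sigma>) (right_extent \<sigma>) / D"
    and local: "spatially_local (\<delta> * D) replan_all \<sigma>"
    using assms by (auto simp: admissible_def)
  let ?T = "Max (fst ` set \<sigma>)"
  note span = extents_span[OF seq assms(1,2) sum]
  have tour: "tour {a..b} (replan_all \<sigma>)" using online seq by (auto simp: online_algorithm_def)
  have by_time: "\<exists>s\<ge>t. s \<le> ?T + (1 + \<delta>) * D \<and> replan_all \<sigma> s = e" if "(t, e) \<in> set \<sigma>" for t e
    using replan_all_serves_by[OF seq assms(1,2) _ local that] assms by (simp add: add.assoc distrib_right)
  then show serves: "serves (replan_all \<sigma>) \<sigma>" by (fastforce simp: serves_def)
  have "completion_time (replan_all \<sigma>) (t, e) \<le> ?T + (1 + \<delta>) * D" if "(t, e) \<in> set \<sigma>" for t e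
    using by_time[OF that] completion_time_le[of t _ "replan_all \<sigma>" e] order_trans by blast
  then have "cost (replan_all \<sigma>) \<sigma> \<le> ?T + (1 + \<delta>) * D"
    using seq by (auto simp: cost_def request_seq_def)
  also have "?T \<le> OPT {a..b} \<sigma>"
    using seq by (intro OPT_ge[OF tour serves] cost_ge_release)
  also have "(1 + \<delta>) * D \<le> (1 + \<delta>) / (1 + \<beta>) * OPT {a..b} \<sigma>"
  proof -
    have "b - a + min (- a) b \<le> OPT {a..b} \<sigma>"
      using seq assms span(3) by (intro OPT_ge[OF tour serves] cost_ge_span)
    \<comment> \<open>Since \<open>\<beta> * D\<close> is the distance from the origin to the nearer
      end, the span bound reads \<open>(1 + \<beta>) * D\<close>; scaling it by the ratio gives
      \<open>(1 + \<delta>) * D\<close>.\<close>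
    moreover have "\<beta> * D = min (- a) b" using \<beta> span assms by simp
    then have "b - a + min (- a) b = (1 + \<beta>) * D" using assms by (simp add: distrib_right)
    ultimately have "(1 + \<delta>) / (1 + \<beta>) * ((1 + \<beta>) * D) \<le> (1 + \<delta>) / (1 + \<beta>) * OPT {a..b} \<sigma>"
      using assms by (intro mult_left_mono) auto
    then show ?thesis using assms by simp
  qed
  finally show "cost (replan_all \<sigma>) \<sigma> \<le> (1 + (1 + \<delta>) / (1 + \<beta>)) * OPT {a..b} \<sigma>"
    by (simp add: algebra_simps)
qed

theorem theorem3:
  fixes a b D \<delta> \<beta> :: real and B :: algorithm
  assumes "a \<le> 0" and "0 \<le> b" and "D = b - a" and "0 < D"
    and "0 \<le> \<delta>" and "\<delta> \<le> 1"
    and "0 \<le> \<beta>" and "\<beta> \<le> 1 / 2"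
    and "competitive {a..b} {\<sigma>. request_seq {a..b} \<sigma>} 2.04 B"
  shows "competitive {a..b} (admissible {a..b} D \<delta> \<beta> (algorithm_A B \<delta> \<beta>))
           (min 2.04 (1 + (1 + \<delta>) / (1 + \<beta>))) (algorithm_A B \<delta> \<beta>)"
proof (cases "1 + (1 + \<delta>) / (1 + \<beta>) \<ge> 2.04")
  case True
  then have "algorithm_A B \<delta> \<beta> = B" by (intro ext) (simp add: algorithm_A_def)
  \<comment> \<open>The guarantee of \<open>B\<close> covers all request sequences, so it restricts
    to the admissible ones.\<close>
  moreover have "admissible {a..b} D \<delta> \<beta> B \<subseteq> {\<sigma>. request_seq {a..b} \<sigma>}"
    by (auto simp: admissible_def)
  ultimately show ?thesis
    using True assms(9) unfolding min_absorb1[OF True] competitive_def by auto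
next
  case False
  then have "algorithm_A B \<delta> \<beta> = replan_all"
    by (intro ext) (simp add: algorithm_A_def replan_all_def)
  moreover have "min 2.04 (1 + (1 + \<delta>) / (1 + \<beta>)) = 1 + (1 + \<delta>) / (1 + \<beta>)" using False by simp
  ultimately show ?thesis using competitive_replan_all[of a b D \<delta> \<beta>] assms by simp
qed

end
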